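(* Let $\mathfrak g$ be a 2-step nilpotent Lie algebra of dimension $d<\infty$ whose first Betti number is equal to $b$. If $\mathfrak h$ is an abelian subalgebra of $\mathfrak g$, then $$\dim(\mathfrak h)\le\frac12+\sqrt{\frac14+b^2+b-2d}+d-b\,.$$
   Context: 2-step nilpotent Lie algebra: a real vector space $\mathfrak g$ with an antisymmetric bilinear bracket $[\,,\,]:\mathfrak g\times\mathfrak g\to\mathfrak g$ such that $[x,[y,z]]=0$ for all $x,y,z\in\mathfrak g$ (abelian Lie algebras are included). First Betti number: $b=b^1(\mathfrak g)=\dim H^1(\mathfrak g)$, where $H^\bullet(\mathfrak g)$ is the Chevalley-Eilenberg cohomology of $\mathfrak g$ with trivial real coefficients; equivalently, $b$ is the dimension of the space of $\varphi\in\mathfrak g^\vee$ such that $[\mathfrak g,\mathfrak g]\subseteq\ker(\varphi)$. *)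

theory Defs
  imports "HOL-Analysis.Analysis" "HOL-Library.Function_Algebras"
begin

instantiation "fun" :: (type, real_vector) real_vector
begin

definition scaleR_fun :: "real \<Rightarrow> ('a \<Rightarrow> 'b) \<Rightarrow> 'a \<Rightarrow> 'b"
    where "scaleR_fun c f = (\<lambda>x. c *\<^sub>R f x)"

instance
  by standard (auto simp: scaleR_fun_def fun_eq_iff plus_fun_def algebra_simps)

end

locale two_step_nilpotent_Lie_algebra =
  fixes bracket :: "'a::real_vector \<Rightarrow> 'a \<Rightarrow> 'a"
  assumes bilinear_bracket: "bilinear bracket"
    and antisymmetric: "bracket x y = - bracket y x"
    and two_step: "bracket x (bracket y z) = 0"

definition Lie_subalgebra :: "('a::real_vector \<Rightarrow> 'a \<Rightarrow> 'a) \<Rightarrow> 'a set \<Rightarrow> bool"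
  where "Lie_subalgebra bracket \<hh> \<longleftrightarrow> subspace \<hh> \<and> (\<forall>x\<in>\<hh>. \<forall>y\<in>\<hh>. bracket x y \<in> \<hh>)"

definition abelian_subalgebra :: "('a::real_vector \<Rightarrow> 'a \<Rightarrow> 'a) \<Rightarrow> 'a set \<Rightarrow> bool"
  where "abelian_subalgebra bracket \<hh> \<longleftrightarrow>
    Lie_subalgebra bracket \<hh> \<and> (\<forall>x\<in>\<hh>. \<forall>y\<in>\<hh>. bracket x y = 0)"

text \<open>
  A \<open>k\<close>-cochain of the Chevalley--Eilenberg complex with trivial real coefficients is an alternating
  \<open>k\<close>-linear form. It is encoded as a function on argument lists that vanishes on all lists
  of length other than \<open>k\<close>, so that each form has exactly one representative.
\<close>

definition CE_cochains :: "nat \<Rightarrow> ('a::real_vector list \<Rightarrow> real) set"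
  where "CE_cochains k = {\<omega>.
    (\<forall>xs. length xs \<noteq> k \<longrightarrow> \<omega> xs = 0) \<and>
    (\<forall>xs i. length xs = k \<and> i < k \<longrightarrow> linear (\<lambda>x. \<omega> (xs[i := x]))) \<and>
    (\<forall>xs i j. length xs = k \<and> i < j \<and> j < k \<and> xs ! i = xs ! j \<longrightarrow> \<omega> xs = 0)}"

text \<open>
  The differential is
  \<open>(d \<omega>)(x\<^sub>0, \<dots>, x\<^sub>k) = (\<Sum>i<j. (-1)^(i+j) \<omega>([x\<^sub>i, x\<^sub>j], x\<^sub>0, \<dots>, x\<^sub>k))\<close>,
  where \<open>x\<^sub>i\<close> and \<open>x\<^sub>j\<close> are omitted from the trailing arguments of \<open>\<omega>\<close>. The terms involving an action on the
  coefficients are absent because the coefficients are trivial.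
\<close>

definition CE_differential ::
    "('a::real_vector \<Rightarrow> 'a \<Rightarrow> 'a) \<Rightarrow> ('a list \<Rightarrow> real) \<Rightarrow> 'a list \<Rightarrow> real"
  where "CE_differential bracket \<omega> xs =
    (\<Sum>j<length xs. \<Sum>i<j. (-1) ^ (i + j) * \<omega> (bracket (xs ! i) (xs ! j) # nths xs (- {i, j})))"

definition CE_cocycles :: "('a::real_vector \<Rightarrow> 'a \<Rightarrow> 'a) \<Rightarrow> nat \<Rightarrow> ('a list \<Rightarrow> real) set"
  where "CE_cocycles bracket k = {\<omega> \<in> CE_cochains k. CE_differential bracket \<omega> = 0}"

definition CE_coboundaries :: "('a::real_vector \<Rightarrow> 'a \<Rightarrow> 'a) \<Rightarrow> nat \<Rightarrow> ('a list \<Rightarrow> real) set"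
  where "CE_coboundaries bracket k =
    (case k of 0 \<Rightarrow> {0} | Suc j \<Rightarrow> CE_differential bracket ` CE_cochains j)"

text \<open>
  For a finite-dimensional Lie algebra all cochain spaces are finite-dimensional, and the following
  difference is the dimension of the quotient of the cocycles by the coboundaries.
\<close>

definition betti_number :: "('a::real_vector \<Rightarrow> 'a \<Rightarrow> 'a) \<Rightarrow> nat \<Rightarrow> nat"
  where "betti_number bracket k = dim (CE_cocycles bracket k) - dim (CE_coboundaries bracket k)"

end

theory Submission
  imports Defs
begin

text \<open>
  Let \<open>W\<close> be the span of all brackets. A 1-cocycle is a linear functional that vanishes on \<open>W\<close>,
  and the only 1-coboundary is zero, so \<open>b\<close> is the codimension of \<open>W\<close> and \<open>dim W = d - b\<close>.

  Since \<open>W\<close> is central, adding it to the abelian subalgebra keeps all brackets zero. Choose a basis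
  \<open>S\<close> of \<open>W\<close>, extend it by \<open>P\<close> to a basis of \<open>\<hh> + W\<close>, and extend that to a basis \<open>S \<union> T\<close> of the
  whole algebra with \<open>P \<subseteq> T\<close>; then \<open>T\<close> has \<open>b\<close> elements. Put \<open>p = card P\<close>. Brackets with an entry in
  \<open>S\<close> vanish, so \<open>W\<close> is spanned by the brackets of pairs from \<open>T\<close>; by antisymmetry only unordered
  pairs of distinct elements matter, and pairs inside \<open>P\<close> contribute zero. Hence
  \<open>d - b \<le> (b choose 2) - (p choose 2)\<close>, that is, \<open>(p - 1/2)\<^sup>2 \<le> 1/4 + b\<^sup>2 + b - 2 d\<close>. The claim
  follows from \<open>dim \<hh> \<le> p + (d - b)\<close>. The counting is in \<open>card_pairs_bound\<close>, the computation of
  the Betti number in \<open>betti_number_1_eq_card\<close>.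
\<close>

section \<open>Degree-one cohomology\<close>

text \<open>
  A form of degree one is only sensitive to lists of length one. A differential term of a list of
  length \<open>n\<close> feeds it a list of length \<open>n - 1\<close>, so only \<open>n = 2\<close> survives.
\<close>

lemma CE_differential_degree_1:
  assumes "\<And>xs. length xs \<noteq> 1 \<Longrightarrow> \<omega> xs = 0"
  shows "CE_differential bracket \<omega> xs =
    (if length xs = 2 then - \<omega> [bracket (xs ! 0) (xs ! 1)] else 0)"
proof (cases "length xs = 2")
  case True
  then obtain x y where xs: "xs = [x, y]"
    by (auto simp: numeral_2_eq_2 length_Suc_conv)
  show ?thesis
    by (simp add: xs CE_differential_def nths_Cons numeral_2_eq_2)
next
  case False
  have "\<omega> (bracket (xs ! i) (xs ! j) # nths xs (- {i, j})) = 0" if "j < length xs" "i < j" for i j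
  proof -
    \<comment> \<open>A list with at least three entries retains one after the omission of two, so \<open>\<omega>\<close> sees too many.\<close>
    have "\<exists>k<3. k \<notin> {i, j}"
      by (rule ccontr) (auto simp: numeral_3_eq_3 less_Suc_eq all_conj_distrib)
    moreover have "3 \<le> length xs"
      using that False by linarith
    ultimately obtain k where "k < length xs" "k \<notin> {i, j}"
      using less_le_trans by blast
    then have "xs ! k \<in> set (nths xs (- {i, j}))"
      by (auto simp: set_nths)
    then have "nths xs (- {i, j}) \<noteq> []"
      by auto
    then show ?thesis
      by (intro assms) simp
  qed
  then show ?thesis
    using False by (simp add: CE_differential_def)
qed

lemma CE_cocycles_1:
  "CE_cocycles bracket 1 =
    {\<omega>. (\<forall>xs. length xs \<noteq> 1 \<longrightarrow> \<omega> xs = 0) \<and> linear (\<lambda>x. \<omega> [x]) \<and> (\<forall>x y. \<omega> [bracket x y] = 0)}"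
  (is "_ = ?R")
proof (intro set_eqI iffI)
  fix \<omega> assume \<omega>: "\<omega> \<in> CE_cocycles bracket 1"
  then have supp: "\<omega> xs = 0" if "length xs \<noteq> 1" for xs
    using that by (auto simp: CE_cocycles_def CE_cochains_def)
  have "\<forall>xs i. length xs = 1 \<and> i < 1 \<longrightarrow> linear (\<lambda>x. \<omega> (xs[i := x]))"
    using \<omega> unfolding CE_cocycles_def CE_cochains_def by blast
  from this[rule_format, of "[0]" 0] have "linear (\<lambda>x. \<omega> [x])"
    by simp
  moreover have "\<omega> [bracket x y] = 0" for x y
  proof -
    have "CE_differential bracket \<omega> [x, y] = 0"
      using \<omega> by (simp add: CE_cocycles_def zero_fun_def)
    then show ?thesis
      using supp by (simp add: CE_differential_degree_1)
  qed
  ultimately show "\<omega> \<in> ?R"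
    using supp by simp
next
  fix \<omega> assume \<omega>: "\<omega> \<in> ?R"
  then have "linear (\<lambda>x. \<omega> (xs[i := x]))" if "length xs = 1" "i < 1" for xs i
    using that by (auto simp: length_Suc_conv)
  moreover have "CE_differential bracket \<omega> = 0"
    using \<omega> by (auto simp: CE_differential_degree_1 fun_eq_iff)
  ultimately show "\<omega> \<in> CE_cocycles bracket 1"
    using \<omega> by (auto simp: CE_cocycles_def CE_cochains_def)
qed

text \<open>
  With trivial coefficients the differential of a constant is zero: a degree-zero form is only
  sensitive to the empty list, which the differential never supplies.
\<close>

lemma CE_coboundaries_1: "CE_coboundaries bracket 1 = {0}"
proof -
  have "CE_differential bracket \<omega> = 0" if "\<omega> \<in> CE_cochains 0" for \<omega>
    using that by (auto simp: CE_cochains_def CE_differential_def fun_eq_iff)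
  moreover have "0 \<in> CE_cochains 0"
    by (auto simp: CE_cochains_def)
  ultimately have "CE_differential bracket ` CE_cochains 0 = {0}"
    by force
  then show ?thesis
    by (simp add: CE_coboundaries_def)
qed

text \<open>
  The coordinate functionals of the basis vectors in \<open>T\<close> form a basis of the annihilator of the
  derived algebra \<open>span S\<close>: evaluation at \<open>t \<in> T\<close> reads off the coefficients.
\<close>

lemma betti_number_1_eq_card:
  fixes bracket :: "'a::real_vector \<Rightarrow> 'a \<Rightarrow> 'a"
  assumes indep: "independent (S \<union> T)" and UNIV: "span (S \<union> T) = UNIV"
    and disj: "S \<inter> T = {}" and fin: "finite T"
    and S: "span S = span {bracket x y | x y. True}"
  shows "betti_number bracket 1 = card T"
proof -
  define \<delta> :: "'a \<Rightarrow> 'a list \<Rightarrow> real"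
    where "\<delta> t xs = (if length xs = 1 then representation (S \<union> T) (hd xs) t else 0)" for t xs
  let ?Z = "CE_cocycles bracket 1"
  have \<delta>_basis: "\<delta> t [x] = (if x = t then 1 else 0)" if "x \<in> S \<union> T" for x t
    using that indep by (simp add: \<delta>_def real_vector.representation_basis)
  have linear_\<delta>: "linear (\<lambda>x. \<delta> t [x])" for t
    using indep UNIV
    by (auto simp: \<delta>_def real_vector.representation_add real_vector.representation_scale intro!: linearI)
  have \<delta>_cocycle: "\<delta> t \<in> ?Z" if "t \<in> T" for t
  proof -
    have "\<delta> t [x] = 0" if "x \<in> span S" for x
      using linear_eq_0_on_span[OF linear_\<delta> _ that] \<delta>_basis disj \<open>t \<in> T\<close> by force
    then have "\<delta> t [bracket x y] = 0" for x y
      unfolding S by (auto intro: span_base)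
    then show ?thesis
      using linear_\<delta> unfolding CE_cocycles_1 by (simp add: \<delta>_def)
  qed
  have expand: "\<omega> = (\<Sum>t\<in>T. \<omega> [t] *\<^sub>R \<delta> t)" if \<omega>: "\<omega> \<in> ?Z" for \<omega>
  proof
    fix xs
    have sum_apply: "(\<Sum>t\<in>T. \<omega> [t] *\<^sub>R \<delta> t) ys = (\<Sum>t\<in>T. \<omega> [t] * \<delta> t ys)" for ys
      using fin by (induction T) (auto simp: scaleR_fun_def)
    have lin: "linear (\<lambda>x. \<omega> [x])" and zero: "\<And>x y. \<omega> [bracket x y] = 0"
      using \<omega> unfolding CE_cocycles_1 by auto
    have \<omega>_S: "\<omega> [x] = 0" if "x \<in> S" for x
      using linear_eq_0_on_span[OF lin, of "{bracket x y | x y. True}"] zero that S span_base by blast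
    have "\<omega> [x] = (\<Sum>t\<in>T. \<omega> [t] * \<delta> t [x])" for x
    proof (rule linear_eq_on_span[OF lin])
      show "linear (\<lambda>x. \<Sum>t\<in>T. \<omega> [t] * \<delta> t [x])"
        using linear_compose_scale_right[OF linear_\<delta>] by (auto intro!: linear_compose_sum)
      show "\<omega> [y] = (\<Sum>t\<in>T. \<omega> [t] * \<delta> t [y])" if "y \<in> S \<union> T" for y
      proof -
        have "(\<Sum>t\<in>T. \<omega> [t] * \<delta> t [y]) = (\<Sum>t\<in>T. if y = t then \<omega> [t] else 0)"
          using \<delta>_basis[OF that] by (intro sum.cong) auto
        then show ?thesis
          using that fin disj \<omega>_S by auto
      qed
      show "x \<in> span (S \<union> T)"
        using UNIV by simp
    qed
    moreover have "\<omega> xs = (\<Sum>t\<in>T. \<omega> [t] * \<delta> t xs)" if "length xs \<noteq> 1"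
      using that \<omega> unfolding CE_cocycles_1 by (simp add: \<delta>_def)
    ultimately show "\<omega> xs = (\<Sum>t\<in>T. \<omega> [t] *\<^sub>R \<delta> t) xs"
      unfolding sum_apply by (metis One_nat_def length_0_conv length_Suc_conv)
  qed
  have inj: "inj_on \<delta> T"
    by (rule inj_onI) (metis UnCI \<delta>_basis zero_neq_one)
  have "independent (\<delta> ` T)"
  proof (rule independent_if_scalars_zero)
    show "finite (\<delta> ` T)"
      using fin by simp
    fix u \<phi>
    assume sum0: "(\<Sum>\<phi>\<in>\<delta> ` T. u \<phi> *\<^sub>R \<phi>) = 0" and "\<phi> \<in> \<delta> ` T"
    then obtain t where t: "t \<in> T" "\<phi> = \<delta> t"
      by auto
    have "0 = (\<Sum>s\<in>T. u (\<delta> s) *\<^sub>R \<delta> s) [t]"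
      using sum0 by (simp add: sum.reindex[OF inj] zero_fun_def)
    also have "\<dots> = (\<Sum>s\<in>T. u (\<delta> s) * \<delta> s [t])"
      using fin by (induction T) (auto simp: scaleR_fun_def)
    also have "\<dots> = (\<Sum>s\<in>T. if t = s then u (\<delta> s) else 0)"
      using \<delta>_basis t by (intro sum.cong) auto
    also have "\<dots> = u \<phi>"
      using t fin by simp
    finally show "u \<phi> = 0"
      by simp
  qed
  moreover have "?Z \<subseteq> span (\<delta> ` T)"
  proof
    fix \<omega> assume "\<omega> \<in> ?Z"
    then have "\<omega> = (\<Sum>t\<in>T. \<omega> [t] *\<^sub>R \<delta> t)"
      by (rule expand)
    moreover have "(\<Sum>t\<in>T. \<omega> [t] *\<^sub>R \<delta> t) \<in> span (\<delta> ` T)"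
      by (intro span_sum span_scale span_base) auto
    ultimately show "\<omega> \<in> span (\<delta> ` T)"
      by simp
  qed
  ultimately have "dim ?Z = card (\<delta> ` T)"
    using \<delta>_cocycle by (intro dim_unique[of "\<delta> ` T"]) auto
  moreover have "dim {0 :: 'a list \<Rightarrow> real} = 0"
    using dim_eq_card[of "{}" "{0 :: 'a list \<Rightarrow> real}"] span_insert_0[of "{}"] independent_empty by auto
  ultimately show ?thesis
    unfolding betti_number_def CE_coboundaries_1 by (simp add: card_image[OF inj])
qed

section \<open>Spanning the derived algebra\<close>

lemma bilinear_in_subspace:
  assumes "bilinear f" "subspace U" "\<And>x y. x \<in> A \<Longrightarrow> y \<in> A \<Longrightarrow> f x y \<in> U"
    and "x \<in> span A" "y \<in> span A"
  shows "f x y \<in> U"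
proof -
  have "f x y \<in> U" if "x \<in> A" for x
    using assms(5)
  proof (rule span_induct)
    show "subspace {y. f x y \<in> U}"
      using assms(1,2)
      by (auto simp: subspace_def bilinear_radd bilinear_rmul bilinear_rzero)
  qed (use assms(3) that in auto)
  moreover have "subspace {x. f x y \<in> U}"
    using assms(1,2)
    by (auto simp: subspace_def bilinear_ladd bilinear_lmul bilinear_lzero)
  ultimately show ?thesis
    using span_induct[OF assms(4)] by blast
qed

text \<open>
  The pairs are unordered and the two possible brackets differ by a sign, so one choice for each
  two-element subset of \<open>T\<close> suffices, and the subsets of \<open>P\<close> may be left out because their
  brackets are zero.
\<close>

lemma card_pairs_bound:
  fixes f :: "'a::real_vector \<Rightarrow> 'a \<Rightarrow> 'b::real_vector"
  assumes anti: "\<And>x y. f x y = - f y x" and fin: "finite T" and "P \<subseteq> T"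
    and zero: "\<And>x y. x \<in> P \<Longrightarrow> y \<in> P \<Longrightarrow> f x y = 0"
  shows "dim {f x y | x y. x \<in> T \<and> y \<in> T} + (card P choose 2) \<le> card T choose 2"
proof -
  define E where "E = {e. e \<subseteq> T \<and> card e = 2} - {e. e \<subseteq> P \<and> card e = 2}"
  define g where "g e = (SOME v. \<exists>x y. e = {x, y} \<and> v = f x y)" for e
  have finE: "finite E"
    using fin by (auto simp: E_def)
  have g: "f x y = g {x, y} \<or> f x y = - g {x, y}" for x y
  proof -
    have "\<exists>v x' y'. {x, y} = {x', y'} \<and> v = f x' y'"
      by blast
    then have "\<exists>x' y'. {x, y} = {x', y'} \<and> g {x, y} = f x' y'"
      unfolding g_def by (rule someI_ex)
    then show ?thesis
      by (metis anti doubleton_eq_iff)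
  qed
  have diag: "f x x = 0" for x
  proof -
    have "2 *\<^sub>R f x x = 0"
      using anti[of x x] by (metis eq_neg_iff_add_eq_0 scaleR_2)
    then show ?thesis by simp
  qed
  have "f x y \<in> span (g ` E)" if "x \<in> T" "y \<in> T" for x y
  proof (cases "{x, y} \<in> E")
    case True
    then have "g {x, y} \<in> span (g ` E)"
      by (intro span_base) auto
    then show ?thesis
      using g[of x y] by (auto simp: span_neg)
  next
    case False
    then have "f x y = 0"
      using that diag zero by (cases "x = y") (auto simp: E_def)
    then show ?thesis
      by (simp add: span_zero)
  qed
  then have "dim {f x y | x y. x \<in> T \<and> y \<in> T} \<le> card (g ` E)"
    using finE by (intro dim_le_card) auto
  also have "\<dots> \<le> card E"
    by (rule card_image_le[OF finE])
  finally have "dim {f x y | x y. x \<in> T \<and> y \<in> T} \<le> card E" .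
  moreover have "card E + (card P choose 2) = card T choose 2"
  proof -
    have "finite P"
      using fin \<open>P \<subseteq> T\<close> by (rule rev_finite_subset)
    have "E \<union> {e. e \<subseteq> P \<and> card e = 2} = {e. e \<subseteq> T \<and> card e = 2}"
      using \<open>P \<subseteq> T\<close> by (auto simp: E_def)
    moreover have "card (E \<union> {e. e \<subseteq> P \<and> card e = 2}) = card E + card {e. e \<subseteq> P \<and> card e = 2}"
      using finE \<open>finite P\<close> by (intro card_Un_disjoint) (auto simp: E_def)
    ultimately show ?thesis
      using n_subsets[OF fin, of 2] n_subsets[OF \<open>finite P\<close>, of 2] by simp
  qed
  ultimately show ?thesis
    by simp
qed

section \<open>The bound for abelian subalgebras\<close>

theorem corollary29:
  fixes bracket :: "'a::real_vector \<Rightarrow> 'a \<Rightarrow> 'a" and \<hh> :: "'a set" and d b :: nat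
  assumes "two_step_nilpotent_Lie_algebra bracket"
    and "\<exists>B::'a set. finite B \<and> span B = UNIV"
    and "dim (UNIV :: 'a set) = d"
    and "betti_number bracket 1 = b"
    and "abelian_subalgebra bracket \<hh>"
  shows "real (dim \<hh>) \<le> 1 / 2 + sqrt (1 / 4 + real b ^ 2 + real b - 2 * real d) + real d - real b"
proof -
  interpret two_step_nilpotent_Lie_algebra bracket
    by (rule assms(1))
  let ?W = "{bracket x y | x y. True}"
  have finite_indep: "finite A" if "independent A" for A :: "'a set"
    using assms(2) independent_span_bound[OF _ that] by auto
  obtain S where S: "S \<subseteq> ?W" "independent S" "?W \<subseteq> span S"
    by (rule maximal_independent_subset)
  obtain R where R: "S \<subseteq> R" "R \<subseteq> \<hh> \<union> S" "independent R" "\<hh> \<union> S \<subseteq> span R"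
    by (rule maximal_independent_subset_extend[OF _ S(2), of "\<hh> \<union> S"]) auto
  obtain B where B: "R \<subseteq> B" "independent B" "span B = UNIV"
    by (rule maximal_independent_subset_extend[OF _ R(3), of UNIV]) auto
  define P where "P = R - S"
  define T where "T = B - S"
  have fin: "finite S" "finite R" "finite B" "finite P" "finite T"
    using finite_indep S R B by (auto simp: P_def T_def)
  have B_eq: "B = S \<union> T" and ST: "S \<inter> T = {}"
    using R B by (auto simp: T_def)
  have "P \<subseteq> T"
    using B by (auto simp: P_def T_def)
  have span_S: "span S = span ?W"
    using S span_eq span_base by blast
  have card_T: "card T = b"
    using betti_number_1_eq_card[of S T bracket] B B_eq ST fin span_S assms(4) by simp
  have card_ST: "card S + b = d"
    using dim_eq_card[of B UNIV] B B_eq ST fin assms(3) card_Un_disjoint[of S T] card_T by simp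

  \<comment> \<open>The set \<open>S\<close> consists of brackets, so this is two-step nilpotency.\<close>
  have central: "bracket x s = 0" "bracket s x = 0" if "s \<in> S" for x s
    using that S(1) two_step antisymmetric[of s x] by auto
  have "bracket x y = 0" if "x \<in> P" "y \<in> P" for x y
    using that R(2) assms(5) by (auto simp: P_def abelian_subalgebra_def)
  then have pairs: "dim {bracket x y | x y. x \<in> T \<and> y \<in> T} + (card P choose 2) \<le> card T choose 2"
    using antisymmetric fin(5) \<open>P \<subseteq> T\<close> by (intro card_pairs_bound)
  have "bracket x y \<in> span {bracket x y | x y. x \<in> T \<and> y \<in> T}" for x y
  proof (rule bilinear_in_subspace[OF bilinear_bracket])
    show "bracket x y \<in> span {bracket x y | x y. x \<in> T \<and> y \<in> T}" if "x \<in> B" "y \<in> B" for x y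
    proof (cases "x \<in> T \<and> y \<in> T")
      case True
      then show ?thesis by (intro span_base) auto
    next
      case False
      then have "bracket x y = 0"
        using that B_eq central by auto
      then show ?thesis by (simp add: span_zero)
    qed
  qed (use B in auto)
  then have "span {bracket x y | x y. x \<in> T \<and> y \<in> T} = span S"
    unfolding span_S by (auto simp: span_eq intro: span_base)
  then have "dim {bracket x y | x y. x \<in> T \<and> y \<in> T} = card S"
    using S(2) by (intro dim_eq_card) auto
  then have "card S + (card P choose 2) \<le> b choose 2"
    using pairs card_T by simp
  moreover have "real (n choose 2) = real n * (real n - 1) / 2" for n
    by (induction n) (auto simp: numeral_2_eq_2 field_simps)
  ultimately have "real (card S) + real (card P) * (real (card P) - 1) / 2 \<le> real b * (real b - 1) / 2"
    by (metis of_nat_add of_nat_le_iff)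
  moreover have "real (card S) = real d - real b"
    using card_ST by linarith
  \<comment> \<open>Substituting \<open>card S = d - b\<close> and completing the square in \<open>card P\<close>.\<close>
  ultimately have "(real (card P) - 1 / 2)\<^sup>2 \<le> 1 / 4 + real b ^ 2 + real b - 2 * real d"
    by (simp add: power2_eq_square field_simps)
  then have "real (card P) - 1 / 2 \<le> sqrt (1 / 4 + real b ^ 2 + real b - 2 * real d)"
    by (rule real_le_rsqrt)
  moreover have "dim \<hh> \<le> card S + card P"
  proof -
    have "dim \<hh> \<le> card R"
      using R(4) fin(2) by (intro dim_le_card) auto
    also have "\<dots> = card S + card P"
      using fin R(1) by (simp add: P_def card_Diff_subset card_mono)
    finally show ?thesis .
  qed
  ultimately show ?thesis
    using card_ST by linarith
qed

end
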